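(* Let $d\ge2$ be an integer and $q$ a prime power. Let $(\mathfrak{x}_k)_k$ be a sequence in $[\mathcal{L}_d]$ such that $[A]\mathfrak{x}_k$ is compact for every $k$ and such that, for every choice of $a_k\in[A]$, any limit point $\mathfrak{x}\in[\mathcal{L}_d]$ of the sequence $(a_k\mathfrak{x}_k)_k$ (that is, the limit of a convergent subsequence) satisfies $\mathfrak{x}\in[A][\mathcal{R}^d]$. Let $\mu_{[A]\mathfrak{x}_k}$ be the unique $[A]$-invariant probability measure supported on $[A]\mathfrak{x}_k$. Then the measures $\mu_{[A]\mathfrak{x}_k}$ converge to the zero measure.
   Context: Let $\mathcal{R}=\mathbb{F}_q[x]$, $\mathcal{K}=\mathbb{F}_q(x)$, with absolute value $|f/g|=q^{\deg f-\deg g}$, and let $\tilde{\mathcal{K}}=\mathbb{F}_q((x^{-1}))$ be the completion. Let $G=\operatorname{GL}_d(\tilde{\mathcal{K}})$, $\Gamma=\operatorname{GL}_d(\mathcal{R})$, $[G]=\operatorname{PGL}_d(\tilde{\mathcal{K}})=G/\tilde{\mathcal{K}}^*I$, and let $[\Gamma]$ be the image of $\Gamma$ in $[G]$. The space $[\mathcal{L}_d]=[G]/[\Gamma]$ (quotient topology, a locally compact space) is identified with the space of lattices $g\mathcal{R}^d\subseteq\tilde{\mathcal{K}}^d$, $g\in G$, up to homothety. $[A]$ is the group of (images in $[G]$ of) invertible diagonal matrices, acting on $[\mathcal{L}_d]$ by left multiplication. $[\mathcal{R}^d]$ is the homothety class of $\mathcal{R}^d$. Convergence of measures is weak-* convergence,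 i.e. tested against continuous compactly supported functions on $[\mathcal{L}_d]$. *)

theory Defs
  imports
    "HOL-Probability.Probability"
    "HOL-Algebra.Left_Coset"
    "HOL-Computational_Algebra.Formal_Laurent_Series"
begin

no_notation fps_nth (infixl \<open>$\<close> 75)

text \<open>
  The field \<open>'a :: {field, finite}\<close> is the finite field with \<open>q = CARD('a)\<close> elements. Its type
  \<open>'a fls\<close> of formal Laurent series is the completion of \<open>'a(x)\<close> at infinity, with \<open>fls_X\<close>
  playing the role of the inverse of \<open>x\<close> and \<open>fls_X_inv\<close> that of \<open>x\<close>.

  The library metric on \<open>'a fls\<close> is \<open>2 powi (- fls_subdegree (f - g))\<close>, whereas the absolute value
  in question gives \<open>q powi (- fls_subdegree (f - g))\<close>. The two induce the same topology,
  and nothing but the topology is used below.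
\<close>

definition of_R :: "'a::field poly \<Rightarrow> 'a fls" where
  "of_R p = poly (map_poly fls_const p) fls_X_inv"

section \<open>Quotient topology, Borel measures and weak-* convergence\<close>

definition quot_topology :: "'b topology \<Rightarrow> ('b \<Rightarrow> 'c) \<Rightarrow> 'c topology" where
  "quot_topology X f =
     topology (\<lambda>U. U \<subseteq> f ` topspace X \<and> openin X {x \<in> topspace X. f x \<in> U})"

definition borel_of_top :: "'b topology \<Rightarrow> 'b measure" where
  "borel_of_top X = sigma (topspace X) {U. openin X U}"

definition compactly_supported :: "'b topology \<Rightarrow> ('b \<Rightarrow> real) \<Rightarrow> bool" where
  "compactly_supported X f \<longleftrightarrow> compactin X (X closure_of {y \<in> topspace X. f y \<noteq> 0})"

definition weak_star_converges :: "'b topology \<Rightarrow> (nat \<Rightarrow> 'b measure) \<Rightarrow> 'b measure \<Rightarrow> bool" where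
  "weak_star_converges X M N \<longleftrightarrow>
     (\<forall>f. continuous_map X euclideanreal f \<and> compactly_supported X f \<longrightarrow>
        (\<lambda>k. integral\<^sup>L (M k) f) \<longlonglongrightarrow> integral\<^sup>L N f)"

section \<open>The groups\<close>

text \<open>The dimension \<open>d\<close> is \<open>CARD('n)\<close>.\<close>

definition GL :: "('a::field fls ^ 'n ^ 'n) monoid" where
  "GL = \<lparr>carrier = {g. invertible g}, mult = (**), one = mat 1\<rparr>"

definition scalars :: "('a::field fls ^ 'n ^ 'n) set" where
  "scalars = {mat c |c. c \<noteq> 0}"

definition PGL :: "('a::field fls ^ 'n ^ 'n) set monoid" where
  "PGL = GL Mod scalars"

definition proj :: "'a::field fls ^ 'n ^ 'n \<Rightarrow> ('a fls ^ 'n ^ 'n) set" where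
  "proj g = scalars #>\<^bsub>GL\<^esub> g"

definition PGL_topology :: "('a::field fls ^ 'n ^ 'n) set topology" where
  "PGL_topology = quot_topology (subtopology euclidean (carrier GL)) proj"

text \<open>\<open>GL_R\<close> is the group of matrices invertible over the polynomial ring, inside \<open>GL\<close>.\<close>

definition GL_R :: "('a::field fls ^ 'n ^ 'n) set" where
  "GL_R = map_matrix of_R ` {\<gamma> :: 'a poly ^ 'n ^ 'n. invertible \<gamma>}"

definition PGL_R :: "('a::field fls ^ 'n ^ 'n) set set" where
  "PGL_R = proj ` GL_R"

definition PA :: "('a::field fls ^ 'n ^ 'n) set set" where
  "PA = proj ` {a \<in> carrier GL. \<forall>i j. i \<noteq> j \<longrightarrow> a $ i $ j = 0}"

section \<open>The space of lattices up to homothety\<close>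

text \<open>
  A point of the space is a left coset of \<open>PGL_R\<close> in \<open>PGL\<close>. The coset of the class of \<open>g\<close> stands for
  the homothety class of the lattice \<open>lat g\<close>, the image of the integral vectors under \<open>g\<close>;
  see \<open>lat_class_eq_iff\<close> below.
\<close>

definition lat_class :: "'a::field fls ^ 'n ^ 'n \<Rightarrow> ('a fls ^ 'n ^ 'n) set set" where
  "lat_class g = proj g <#\<^bsub>PGL\<^esub> PGL_R"

definition Ld_topology :: "('a::field fls ^ 'n ^ 'n) set set topology" where
  "Ld_topology = quot_topology PGL_topology (\<lambda>u. u <#\<^bsub>PGL\<^esub> PGL_R)"

definition std_class :: "('a::field fls ^ 'n ^ 'n) set set" where
  "std_class = lat_class (mat 1)"

text \<open>
  As points are cosets, left translation by \<open>a\<close> is \<open>l_coset PGL a\<close>; see \<open>act_lat_class\<close> below.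
\<close>

definition act ::
  "('a::field fls ^ 'n ^ 'n) set \<Rightarrow> ('a fls ^ 'n ^ 'n) set set \<Rightarrow> ('a fls ^ 'n ^ 'n) set set" where
  "act a y = a <#\<^bsub>PGL\<^esub> y"

definition A_orbit :: "('a::field fls ^ 'n ^ 'n) set set \<Rightarrow> ('a fls ^ 'n ^ 'n) set set set" where
  "A_orbit y = (\<lambda>a. act a y) ` PA"

text \<open>
  For a compact orbit, which is then closed, the last condition says that \<open>M\<close> is supported on it.
\<close>

definition is_orbit_measure ::
  "('a::field fls ^ 'n ^ 'n) set set \<Rightarrow> ('a fls ^ 'n ^ 'n) set set measure \<Rightarrow> bool" where
  "is_orbit_measure y M \<longleftrightarrow>
     sets M = sets (borel_of_top Ld_topology) \<and> prob_space M \<and>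
     (\<forall>a\<in>PA. distr M M (act a) = M) \<and>
     (AE z in M. z \<in> A_orbit y)"

section \<open>Consistency of the definitions\<close>

lemma openin_quot_topology:
  "openin (quot_topology X f) U \<longleftrightarrow>
     U \<subseteq> f ` topspace X \<and> openin X {x \<in> topspace X. f x \<in> U}"
proof -
  have "istopology (\<lambda>U. U \<subseteq> f ` topspace X \<and> openin X {x \<in> topspace X. f x \<in> U})"
    unfolding istopology_def
  proof (intro conjI allI impI, goal_cases)
    case (1 S T) then show ?case by blast
  next
    case (2 S T)
    have "{x \<in> topspace X. f x \<in> S \<inter> T} = {x \<in> topspace X. f x \<in> S} \<inter> {x \<in> topspace X. f x \<in> T}"
      by blast
    with 2 show ?case by (simp add: openin_Int)
  next
    case (3 K) then show ?case by blast
  next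
    case (4 K)
    have "{x \<in> topspace X. f x \<in> \<Union>K} = (\<Union>S\<in>K. {x \<in> topspace X. f x \<in> S})" by blast
    with 4 show ?case by auto
  qed
  then show ?thesis by (simp add: quot_topology_def)
qed

lemma quotient_map_quot_topology: "quotient_map X (quot_topology X f) f"
proof -
  have "topspace (quot_topology X f) = f ` topspace X"
  proof
    show "topspace (quot_topology X f) \<subseteq> f ` topspace X"
      using openin_quot_topology[of X f "topspace (quot_topology X f)"] by simp
    have "{x \<in> topspace X. f x \<in> f ` topspace X} = topspace X" by auto
    then have "openin (quot_topology X f) (f ` topspace X)" by (simp add: openin_quot_topology)
    then show "f ` topspace X \<subseteq> topspace (quot_topology X f)" by (rule openin_subset)
  qed
  then show ?thesis by (auto simp: quotient_map_def openin_quot_topology)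
qed

lemma GL_simps [simp]:
  "g \<in> carrier GL \<longleftrightarrow> invertible g" "g \<otimes>\<^bsub>GL\<^esub> h = g ** h" "\<one>\<^bsub>GL\<^esub> = mat 1"
  by (simp_all add: GL_def)

lemma group_GL: "group (GL :: ('a::field fls ^ 'n ^ 'n) monoid)"
proof (rule groupI, goal_cases)
  case (1 g h) then show ?case by (simp add: invertible_mult)
next
  case 2 show ?case by (simp add: invertible_def)
next
  case (3 g h k) then show ?case by (simp add: matrix_mul_assoc)
next
  case (4 g) then show ?case by (simp add: matrix_mul_lid)
next
  case (5 g)
  then obtain h where h: "g ** h = mat 1" "h ** g = mat 1" by (auto simp: invertible_def)
  then have "invertible h" unfolding invertible_def by blast
  with h show ?case by (intro bexI[of _ h]) simp_all
qed

lemma mat_mult_nth: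
  fixes g :: "'a::comm_semiring_1 ^ 'n ^ 'm"
  shows "(mat c ** g) $ i $ j = c * g $ i $ j"
proof -
  have "(mat c ** g) $ i $ j = (\<Sum>k\<in>UNIV. if k = i then c * g $ k $ j else 0)"
    by (simp add: matrix_matrix_mult_def mat_def if_distrib[where f = "\<lambda>z. z * _"] eq_commute
        cong: if_cong)
  then show ?thesis by simp
qed

lemma mult_mat_nth:
  fixes g :: "'a::comm_semiring_1 ^ 'n ^ 'm"
  shows "(g ** mat c) $ i $ j = c * g $ i $ j"
proof -
  have "(g ** mat c) $ i $ j = (\<Sum>k\<in>UNIV. if k = j then c * g $ i $ k else 0)"
    by (simp add: matrix_matrix_mult_def mat_def if_distrib[where f = "\<lambda>z. _ * z"] mult.commute
        cong: if_cong)
  then show ?thesis by simp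
qed

lemma mat_commute: "mat c ** g = g ** (mat c :: 'a::comm_semiring_1 ^ 'n ^ 'n)"
  by (simp add: vec_eq_iff mat_mult_nth mult_mat_nth)

lemma mat_mult_mat: "mat c ** mat e = (mat (c * e) :: 'a::comm_semiring_1 ^ 'n ^ 'n)"
  by (simp add: vec_eq_iff mat_mult_nth) (simp add: mat_def)

lemma invertible_mat: "c \<noteq> 0 \<Longrightarrow> invertible (mat c :: 'a::field ^ 'n ^ 'n)"
  unfolding invertible_def by (rule exI[of _ "mat (inverse c)"]) (simp add: mat_mult_mat)

lemma normal_scalars: "scalars \<lhd> (GL :: ('a::field fls ^ 'n ^ 'n) monoid)"
proof -
  interpret group "GL :: ('a fls ^ 'n ^ 'n) monoid" by (rule group_GL)
  have sub: "subgroup (scalars :: ('a fls ^ 'n ^ 'n) set) GL"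
  proof (rule subgroupI)
    show "scalars \<subseteq> carrier (GL :: ('a fls ^ 'n ^ 'n) monoid)"
      by (auto simp: scalars_def invertible_mat)
    show "scalars \<noteq> ({} :: ('a fls ^ 'n ^ 'n) set)"
      by (auto simp: scalars_def intro: exI[of _ 1])
  next
    fix g :: "'a fls ^ 'n ^ 'n" assume "g \<in> scalars"
    then obtain c where c: "g = mat c" "c \<noteq> 0" by (auto simp: scalars_def)
    have "inv\<^bsub>GL\<^esub> g = mat (inverse c)"
      by (rule inv_equality) (use c in \<open>auto simp: mat_mult_mat invertible_mat\<close>)
    then show "inv\<^bsub>GL\<^esub> g \<in> scalars" using c by (auto simp: scalars_def)
  next
    fix g h :: "'a fls ^ 'n ^ 'n" assume "g \<in> scalars" "h \<in> scalars"
    then show "g \<otimes>\<^bsub>GL\<^esub> h \<in> scalars" by (force simp: scalars_def mat_mult_mat)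
  qed
  show ?thesis
  proof (rule normalI[OF sub], intro ballI)
    fix g :: "'a fls ^ 'n ^ 'n"
    show "scalars #>\<^bsub>GL\<^esub> g = g <#\<^bsub>GL\<^esub> scalars"
      by (auto simp: r_coset_def l_coset_def scalars_def mat_commute)
  qed
qed

lemma group_PGL: "group (PGL :: ('a::field fls ^ 'n ^ 'n) set monoid)"
  unfolding PGL_def by (rule normal.factorgroup_is_group[OF normal_scalars])

lemma carrier_PGL: "carrier PGL = proj ` carrier GL"
  by (auto simp: PGL_def FactGroup_def RCOSETS_def proj_def)

lemma proj_mult:
  "invertible g \<Longrightarrow> invertible h \<Longrightarrow> proj g \<otimes>\<^bsub>PGL\<^esub> proj h = proj (g ** h)"
  using normal.rcos_sum[OF normal_scalars, of g h] by (simp add: PGL_def FactGroup_def proj_def)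

lemma topspace_quot_topology: "topspace (quot_topology X f) = f ` topspace X"
  using quotient_imp_surjective_map[OF quotient_map_quot_topology] by metis

lemma topspace_PGL: "topspace PGL_topology = carrier PGL"
  by (simp add: PGL_topology_def carrier_PGL topspace_quot_topology)

lemma topspace_Ld: "topspace Ld_topology = lcosets\<^bsub>PGL\<^esub> PGL_R"
  by (simp add: Ld_topology_def topspace_quot_topology topspace_PGL LCOSETS_def UNION_singleton_eq_range)

lemma topspace_Ld': "topspace Ld_topology = lat_class ` {g. invertible g}"
  unfolding topspace_Ld by (auto simp: LCOSETS_def carrier_PGL lat_class_def)

definition R_vectors :: "('a::field fls ^ 'n) set" where
  "R_vectors = {v. \<forall>i. v $ i \<in> range of_R}"

definition lat :: "'a::field fls ^ 'n ^ 'n \<Rightarrow> ('a fls ^ 'n) set" where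
  "lat g = (\<lambda>v. g *v v) ` R_vectors"

lemma of_R_0 [simp]: "of_R 0 = 0"
  by (simp add: of_R_def)

lemma of_R_pCons: "of_R (pCons a p) = fls_const a + fls_X_inv * of_R p"
  by (simp add: of_R_def map_poly_pCons)

lemma of_R_1 [simp]: "of_R 1 = 1"
  using of_R_pCons[of "1 :: 'a" 0] by (simp add: pCons_one)

lemma of_R_add: "of_R (p + q) = of_R p + of_R q"
  by (induction p q rule: poly_induct2) (simp_all add: of_R_pCons algebra_simps flip: fls_plus_const)

lemma of_R_smult: "of_R (smult a p) = fls_const a * of_R p"
  by (induction p) (simp_all add: of_R_pCons algebra_simps fls_const_mult_const)

lemma of_R_mult: "of_R (p * q) = of_R p * of_R q"
  by (induction p) (simp_all add: of_R_pCons of_R_add of_R_smult algebra_simps)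

lemma of_R_sum: "of_R (sum f S) = (\<Sum>i\<in>S. of_R (f i))"
  by (induction S rule: infinite_finite_induct) (simp_all add: of_R_add)

text \<open>The coefficient of the \<open>i\<close>-th power of \<open>x\<close> sits at index \<open>-i\<close> of the Laurent series.\<close>

lemma of_R_nth: "fls_nth (of_R p) (- int i) = coeff p i" and of_R_nth_pos: "k > 0 \<Longrightarrow> fls_nth (of_R p) k = 0"
proof -
  have "fls_nth (of_R p) k = (if k \<le> 0 then coeff p (nat (- k)) else 0)" for k
  proof (induction p arbitrary: k)
    case 0 then show ?case by simp
  next
    case (pCons a p)
    then show ?case
      by (auto simp: of_R_pCons fls_X_inv_times_conv_shift coeff_pCons nat_diff_distrib' split: nat.splits)
  qed
  then show "fls_nth (of_R p) (- int i) = coeff p i" "k > 0 \<Longrightarrow> fls_nth (of_R p) k = 0" by auto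
qed

lemma inj_of_R: "inj of_R"
  by (rule injI) (metis of_R_nth poly_eqI)

lemma map_of_R_mult: "map_matrix of_R (\<gamma> ** \<delta>) = map_matrix of_R \<gamma> ** map_matrix of_R \<delta>"
  by (simp add: vec_eq_iff matrix_matrix_mult_def of_R_sum of_R_mult)

lemma map_of_R_1: "map_matrix of_R (mat 1) = mat 1"
  by (simp add: vec_eq_iff mat_def)

lemma map_of_R_inject: "map_matrix of_R \<gamma> = map_matrix of_R \<delta> \<longleftrightarrow> \<gamma> = \<delta>"
  by (auto simp: vec_eq_iff inj_eq[OF inj_of_R])

lemma GL_R_iff:
  "g \<in> GL_R \<longleftrightarrow> (\<exists>h. (\<forall>i j. g $ i $ j \<in> range of_R) \<and> (\<forall>i j. h $ i $ j \<in> range of_R) \<and>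
     g ** h = mat 1 \<and> h ** g = mat 1)" (is "?L \<longleftrightarrow> ?R")
proof
  assume ?L
  then obtain \<gamma> \<delta> where "g = map_matrix of_R \<gamma>" "\<gamma> ** \<delta> = mat 1" "\<delta> ** \<gamma> = mat 1"
    by (auto simp: GL_R_def invertible_def)
  then show ?R
    by (intro exI[of _ "map_matrix of_R \<delta>"]) (simp add: map_of_R_1 flip: map_of_R_mult)
next
  have lift: "\<exists>\<gamma>. g = map_matrix of_R \<gamma>" if "\<forall>i j. g $ i $ j \<in> range of_R" for g :: "'a fls ^ 'b ^ 'b"
    by (rule exI[of _ "map_matrix (inv_into UNIV of_R) g"]) (use that in \<open>simp add: vec_eq_iff f_inv_into_f\<close>)
  assume ?R
  then obtain \<gamma> \<delta> where *: "g = map_matrix of_R \<gamma>" "map_matrix of_R \<gamma> ** map_matrix of_R \<delta> = mat 1"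
      "map_matrix of_R \<delta> ** map_matrix of_R \<gamma> = mat 1"
    using lift by metis
  then have "\<gamma> ** \<delta> = mat 1" "\<delta> ** \<gamma> = mat 1"
    by (metis map_of_R_1 map_of_R_inject map_of_R_mult)+
  with * show ?L by (auto simp: GL_R_def invertible_def)
qed

lemma GL_R_invertible: "g \<in> GL_R \<Longrightarrow> invertible g"
  unfolding GL_R_iff invertible_def by blast

lemma subgroup_GL_R: "subgroup GL_R GL"
proof -
  interpret group "GL :: ('a fls ^ 'b ^ 'b) monoid" by (rule group_GL)
  show ?thesis
  proof (rule subgroupI)
    show "GL_R \<subseteq> carrier GL" by (auto intro: GL_R_invertible)
    show "GL_R \<noteq> {}"
      unfolding GL_R_def by (auto simp: invertible_def intro!: exI[of _ "mat 1"])
  next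
    fix g :: "'a fls ^ 'b ^ 'b" assume g: "g \<in> GL_R"
    then obtain h where h: "h \<in> GL_R" "h ** g = mat 1"
      unfolding GL_R_iff by blast
    then have "inv\<^bsub>GL\<^esub> g = h" using g by (intro inv_equality) (auto intro: GL_R_invertible)
    then show "inv\<^bsub>GL\<^esub> g \<in> GL_R" using h by simp
  next
    fix g h :: "'a fls ^ 'b ^ 'b" assume "g \<in> GL_R" "h \<in> GL_R"
    then show "g \<otimes>\<^bsub>GL\<^esub> h \<in> GL_R"
      by (auto simp: GL_R_def map_of_R_mult[symmetric] invertible_mult)
  qed
qed

lemma proj_hom: "proj \<in> hom GL PGL"
  by (auto simp: hom_def carrier_PGL proj_mult)

lemma group_hom_proj: "group_hom GL PGL proj"
  by (simp add: group_hom_def group_hom_axioms_def group_GL group_PGL proj_hom)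

lemma subgroup_PGL_R: "subgroup PGL_R PGL"
  unfolding PGL_R_def by (rule group_hom.subgroup_img_is_subgroup[OF group_hom_proj subgroup_GL_R])

lemma act_lat_class:
  assumes "invertible a" "invertible g"
  shows "act (proj a) (lat_class g) = lat_class (a ** g)"
  unfolding act_def lat_class_def proj_mult[OF assms, symmetric]
  by (rule group.lcos_m_assoc[OF group_PGL subgroup.subset[OF subgroup_PGL_R]])
    (use assms in \<open>auto simp: carrier_PGL\<close>)

lemma proj_eq_iff:
  assumes "invertible g" "invertible h"
  shows "proj g = proj h \<longleftrightarrow> (\<exists>c. c \<noteq> 0 \<and> g = mat c ** h)"
proof -
  interpret group GL by (rule group_GL)
  have sub: "subgroup scalars GL" by (rule normal_imp_subgroup[OF normal_scalars])
  have "proj g = proj h \<longleftrightarrow> g \<in> scalars #>\<^bsub>GL\<^esub> h"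
    using repr_independence[OF _ _ sub] rcos_self[OF _ sub] assms unfolding proj_def
    by (metis GL_simps(1))
  also have "\<dots> \<longleftrightarrow> (\<exists>c. c \<noteq> 0 \<and> g = mat c ** h)"
    by (auto simp: r_coset_def scalars_def)
  finally show ?thesis .
qed

lemma mat_vec_mult: "mat c *v v = c *s (v :: 'a::comm_semiring_1 ^ 'n)"
  by (simp add: vec_eq_iff matrix_vector_mult_def mat_def if_distrib[where f = "\<lambda>z. z * _"] cong: if_cong)

lemma GL_R_vectors:
  fixes \<gamma> :: "'a::field fls ^ 'n ^ 'n"
  shows "(\<lambda>v. \<gamma> *v v) ` R_vectors \<subseteq> R_vectors \<longleftrightarrow> (\<forall>i j. \<gamma> $ i $ j \<in> range of_R)" (is "?L \<longleftrightarrow> ?R")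
proof
  assume ?L
  show ?R
  proof (intro allI)
    fix i j
    have "(axis j 1 :: 'a fls ^ 'n) \<in> R_vectors"
      by (auto simp: R_vectors_def axis_def intro: range_eqI[where x = 0] range_eqI[where x = 1])
    with \<open>?L\<close> have "\<gamma> *v axis j 1 \<in> R_vectors" by blast
    then show "\<gamma> $ i $ j \<in> range of_R" 
      by (simp add: R_vectors_def matrix_vector_mult_def axis_def if_distrib[where f = "\<lambda>z. _ * z"] cong: if_cong)
  qed
next
  assume R: ?R
  show ?L
  proof clarify
    fix v :: "'a fls ^ 'n" assume v: "v \<in> R_vectors"
    have "(\<Sum>j\<in>UNIV. \<gamma> $ i $ j * v $ j) = of_R (\<Sum>j\<in>UNIV. inv_into UNIV of_R (\<gamma> $ i $ j) * inv_into UNIV of_R (v $ j))" for i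
      using R v by (simp add: of_R_sum of_R_mult f_inv_into_f R_vectors_def)
    then show "\<gamma> *v v \<in> R_vectors"
      by (simp add: R_vectors_def matrix_vector_mult_def)
  qed
qed

lemma GL_R_iff_vectors:
  assumes "invertible \<gamma>"
  shows "\<gamma> \<in> GL_R \<longleftrightarrow> (\<lambda>v. \<gamma> *v v) ` R_vectors = R_vectors"
proof -
  obtain \<delta> where \<delta>: "\<gamma> ** \<delta> = mat 1" "\<delta> ** \<gamma> = mat 1"
    using assms by (auto simp: invertible_def)
  have un: "\<epsilon> = \<delta>" if "\<gamma> ** \<epsilon> = mat 1" for \<epsilon>
    by (metis \<delta>(2) matrix_mul_assoc matrix_mul_lid matrix_mul_rid that)
  have "\<gamma> \<in> GL_R \<longleftrightarrow> (\<lambda>v. \<gamma> *v v) ` R_vectors \<subseteq> R_vectors \<and> (\<lambda>v. \<delta> *v v) ` R_vectors \<subseteq> R_vectors"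
    unfolding GL_R_vectors GL_R_iff using \<delta> un by blast
  also have "(\<lambda>v. \<delta> *v v) ` R_vectors \<subseteq> R_vectors \<longleftrightarrow> R_vectors \<subseteq> (\<lambda>v. \<gamma> *v v) ` R_vectors"
  proof -
    have "\<gamma> *v (\<delta> *v v) = v" "\<delta> *v (\<gamma> *v v) = v" for v
      by (simp_all add: matrix_vector_mul_assoc \<delta>)
    then show ?thesis by (auto simp: subset_iff image_iff) metis+
  qed
  finally show ?thesis by blast
qed

theorem lat_class_eq_iff:
  assumes g: "invertible g" and h: "invertible h"
  shows "lat_class g = lat_class h \<longleftrightarrow> (\<exists>c. c \<noteq> 0 \<and> lat g = (\<lambda>v. c *s v) ` lat h)"
proof -
  interpret P: group PGL by (rule group_PGL)
  have "lat_class g = lat_class h \<longleftrightarrow> proj g \<in> proj h <#\<^bsub>PGL\<^esub> PGL_R"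
    using P.l_repr_independence[OF _ _ subgroup_PGL_R, of "proj g" "proj h"]
      P.lcos_self[OF _ subgroup_PGL_R, of "proj g"] g h
    unfolding lat_class_def by (metis GL_simps(1) carrier_PGL imageI)
  also have "\<dots> \<longleftrightarrow> (\<exists>\<gamma>\<in>GL_R. proj g = proj (h ** \<gamma>))"
    by (auto simp: l_coset_def PGL_R_def proj_mult h GL_R_invertible)
  also have "\<dots> \<longleftrightarrow> (\<exists>\<gamma>\<in>GL_R. \<exists>c. c \<noteq> 0 \<and> g = mat c ** (h ** \<gamma>))"
    by (intro bex_cong refl proj_eq_iff[OF g] invertible_mult h GL_R_invertible)
  also have "\<dots> \<longleftrightarrow> (\<exists>c. c \<noteq> 0 \<and> (\<exists>\<gamma>\<in>GL_R. g = mat c ** (h ** \<gamma>)))"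
    by blast
  also have "\<dots> \<longleftrightarrow> (\<exists>c. c \<noteq> 0 \<and> lat g = (\<lambda>v. c *s v) ` lat h)"
  proof -
    have "(\<exists>\<gamma>\<in>GL_R. g = mat c ** (h ** \<gamma>)) \<longleftrightarrow> lat g = (\<lambda>v. c *s v) ` lat h"
      if c: "c \<noteq> 0" for c
    proof -
      define k where "k = mat c ** h"
      have k: "invertible k" unfolding k_def by (intro invertible_mult invertible_mat c h)
      obtain l where l: "k ** l = mat 1" "l ** k = mat 1" using k by (auto simp: invertible_def)
      define \<gamma> where "\<gamma> = l ** g"
      have g_eq: "g = k ** \<gamma>" by (simp add: \<gamma>_def matrix_mul_assoc l)
      have inv\<gamma>: "invertible \<gamma>"
        unfolding \<gamma>_def by (intro invertible_mult g) (use l in \<open>auto simp: invertible_def\<close>)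
      have uniq: "\<epsilon> = \<gamma>" if "g = k ** \<epsilon>" for \<epsilon>
        by (simp add: \<gamma>_def that matrix_mul_assoc l)
      have injk: "inj (\<lambda>v. k *v v)"
        by (rule inj_on_inverseI[where g = "\<lambda>v. l *v v"]) (simp add: matrix_vector_mul_assoc l)
      have "(\<exists>\<gamma>\<in>GL_R. g = mat c ** (h ** \<gamma>)) \<longleftrightarrow> \<gamma> \<in> GL_R"
        using g_eq uniq by (auto simp: k_def matrix_mul_assoc)
      also have "\<dots> \<longleftrightarrow> (\<lambda>v. \<gamma> *v v) ` R_vectors = R_vectors"
        by (rule GL_R_iff_vectors[OF inv\<gamma>])
      also have "\<dots> \<longleftrightarrow> (\<lambda>v. k *v v) ` (\<lambda>v. \<gamma> *v v) ` R_vectors = (\<lambda>v. k *v v) ` R_vectors"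
        by (simp add: inj_image_eq_iff[OF injk])
      also have "(\<lambda>v. k *v v) ` (\<lambda>v. \<gamma> *v v) ` R_vectors = lat g"
        by (simp add: image_image lat_def g_eq matrix_vector_mul_assoc)
      also have "(\<lambda>v. k *v v) ` R_vectors = (\<lambda>v. c *s v) ` lat h"
        by (simp add: image_image lat_def k_def mat_vec_mult flip: matrix_vector_mul_assoc)
      finally show ?thesis .
    qed
    then show ?thesis by (intro arg_cong[where f = Ex] ext conj_cong refl)
  qed
  finally show ?thesis .
qed

end

theory Submission
  imports Defs
begin

text \<open>
  A compact set \<open>K\<close> of classes is covered by classes of matrices \<open>g\<close> for which both \<open>g\<close> and
  its inverse are bounded in terms of \<open>K\<close> only. If the class of a diagonal matrix \<open>a\<close> lies in \<open>K\<close>,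
  comparing valuations in \<open>a = c g \<gamma>\<close> bounds the differences of the valuations of the diagonal
  entries, since nonzero polynomials have valuation at most \<open>0\<close>. So for \<open>t = diag(X, 1, \<dots>, 1)\<close>
  and large \<open>p\<close> no point \<open>z\<close> of the standard orbit has both \<open>z\<close> and \<open>t ^ p z\<close> in \<open>K\<close>. By sequential
  compactness of \<open>K\<close> and the hypothesis on limit points, for a fixed such \<open>p\<close> the same holds on the
  orbit of \<open>x k\<close> for all large \<open>k\<close>. Hence for each \<open>N\<close> and all large \<open>k\<close>, \<open>N\<close> translates of \<open>K\<close>
  are disjoint up to null sets of \<open>\<mu> k\<close>; they have equal measure by invariance, so \<open>\<mu> k K \<le> 1 / N\<close>.
\<close>

section \<open>Valuation bounds for Laurent series and matrices\<close>

definition val_ge :: "int \<Rightarrow> 'a::zero fls set" where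
  "val_ge m = {f. \<forall>k<m. fls_nth f k = 0}"

definition mat_val_ge :: "int \<Rightarrow> ('a::zero fls ^ 'n ^ 'm) set" where
  "mat_val_ge m = {g. \<forall>i j. g $ i $ j \<in> val_ge m}"

text \<open>By convention \<open>fls_subdegree 0 = 0\<close>, whereas \<open>0\<close> satisfies
  every valuation bound. This is why \<open>val_ge\<close> is phrased by coefficients and the
  subdegree enters only for nonzero series.\<close>

lemma val_ge_iff_subdegree: "f \<noteq> 0 \<Longrightarrow> f \<in> val_ge m \<longleftrightarrow> m \<le> fls_subdegree f"
  by (auto simp: val_ge_def intro: fls_subdegree_geI)

lemma val_ge_0 [simp]: "0 \<in> val_ge m"
  by (simp add: val_ge_def)

lemma val_ge_mono: "f \<in> val_ge n \<Longrightarrow> m \<le> n \<Longrightarrow> f \<in> val_ge m"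
  by (auto simp: val_ge_def)

lemma val_ge_add: "f \<in> val_ge m \<Longrightarrow> g \<in> val_ge m \<Longrightarrow> f + g \<in> val_ge m"
  for f g :: "'a::comm_monoid_add fls"
  by (simp add: val_ge_def)

lemma val_ge_diff: "f \<in> val_ge m \<Longrightarrow> g \<in> val_ge m \<Longrightarrow> f - g \<in> val_ge m"
  for f g :: "'a::ab_group_add fls"
  by (simp add: val_ge_def)

lemma val_ge_sum: "(\<And>i. i \<in> S \<Longrightarrow> f i \<in> val_ge m) \<Longrightarrow> sum f S \<in> val_ge m"
  for f :: "'b \<Rightarrow> 'a::comm_monoid_add fls"
  by (induction S rule: infinite_finite_induct) (auto intro: val_ge_add)

lemma val_ge_mult:
  fixes f g :: "'a::semiring_no_zero_divisors fls"
  assumes "f \<in> val_ge m" "g \<in> val_ge n"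
  shows "f * g \<in> val_ge (m + n)"
proof (cases "f = 0 \<or> g = 0")
  case False
  then have "m + n \<le> fls_subdegree f + fls_subdegree g"
    using assms by (auto simp: val_ge_iff_subdegree)
  then show ?thesis by (auto simp: val_ge_def intro!: fls_times_nth_eq0)
qed auto

section \<open>The metric topology in terms of valuations\<close>

lemma dist_fls_powi:
  "f \<noteq> g \<Longrightarrow> dist f g = 2 powi (- fls_subdegree (f - g))" for f g :: "'a::group_add fls"
  by (auto simp: dist_fls_def power_int_def power_one_over inverse_eq_divide)

text \<open>Powers of two increase strictly with the exponent, so comparing distances is comparing
  subdegrees. The closed balls of radius \<open>2 powi (- m)\<close> are thus the cosets of
  \<open>val_ge m\<close>.\<close>

lemma diff_mem_val_ge_iff_dist:
  "f - g \<in> val_ge m \<longleftrightarrow> dist f g \<le> 2 powi (- m)" for f g :: "'a::ab_group_add fls"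
proof (cases "f = g")
  case False
  have "(2::real) powi (- fls_subdegree (f - g)) \<le> 2 powi (- m) \<longleftrightarrow> m \<le> fls_subdegree (f - g)"
    using power_int_increasing[of "- fls_subdegree (f - g)" "- m" "2::real"]
      power_int_strict_increasing[of "- m" "- fls_subdegree (f - g)" "2::real"]
    by linarith
  with False show ?thesis by (simp add: dist_fls_powi val_ge_iff_subdegree)
qed simp

lemma mat_val_ge_mono: "g \<in> mat_val_ge n \<Longrightarrow> m \<le> n \<Longrightarrow> g \<in> mat_val_ge m"
  by (auto simp: mat_val_ge_def intro: val_ge_mono)

lemma mat_val_ge_add: "g \<in> mat_val_ge m \<Longrightarrow> h \<in> mat_val_ge m \<Longrightarrow> g + h \<in> mat_val_ge m"
  for g h :: "'a::comm_monoid_add fls ^ 'n ^ 'm"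
  by (auto simp: mat_val_ge_def intro: val_ge_add)

lemma mat_val_ge_diff: "g \<in> mat_val_ge m \<Longrightarrow> h \<in> mat_val_ge m \<Longrightarrow> g - h \<in> mat_val_ge m"
  for g h :: "'a::ab_group_add fls ^ 'n ^ 'm"
  by (auto simp: mat_val_ge_def intro: val_ge_diff)

lemma mat_val_ge_mult:
  fixes g :: "'a::idom fls ^ 'n ^ 'm" and h :: "'a fls ^ 'k ^ 'n"
  shows "g \<in> mat_val_ge m \<Longrightarrow> h \<in> mat_val_ge n \<Longrightarrow> g ** h \<in> mat_val_ge (m + n)"
  by (auto simp: mat_val_ge_def matrix_matrix_mult_def intro!: val_ge_sum val_ge_mult)

lemma ex_mat_val_ge: "\<exists>m. g \<in> mat_val_ge m"
proof -
  \<comment> \<open>A zero entry contributes the default subdegree \<open>0\<close>, which can only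
    lower the minimum.\<close>
  define m where "m = Min (range (\<lambda>(i, j). fls_subdegree (g $ i $ j)))"
  have "m \<le> fls_subdegree (g $ i $ j)" for i j
    unfolding m_def by (intro Min_le) (auto intro: image_eqI[where x = "(i, j)"])
  then have "fls_nth (g $ i $ j) k = 0" if "k < m" for i j k
    using that by (intro fls_eq0_below_subdegree) (rule less_le_trans)
  then have "g \<in> mat_val_ge m" by (simp add: mat_val_ge_def val_ge_def)
  then show ?thesis ..
qed

text \<open>The additive subgroups \<open>mat_val_ge m\<close> are a neighbourhood base at
  \<open>0\<close>; openness and continuity below are reduced to valuation estimates in this
  way.\<close>

lemma open_mat_iff:
  fixes U :: "('a::ab_group_add fls ^ 'n ^ 'm) set"
  shows "open U \<longleftrightarrow> (\<forall>g\<in>U. \<exists>m. \<forall>\<delta>\<in>mat_val_ge m. g + \<delta> \<in> U)"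
proof -
  have "(\<exists>e>0. \<forall>h. dist h g < e \<longrightarrow> h \<in> U) \<longleftrightarrow> (\<exists>m. \<forall>\<delta>\<in>mat_val_ge m. g + \<delta> \<in> U)" for g
  proof safe
    fix e :: real assume e: "e > 0" "\<forall>h. dist h g < e \<longrightarrow> h \<in> U"
    \<comment> \<open>On each of the two vector levels the Euclidean distance is at most the sum of
      the coordinate distances, which costs a factor \<open>CARD('n)\<close> and then
      \<open>CARD('m)\<close>.\<close>
    define e' where "e' = e / (real CARD('n) * real CARD('m))"
    have "e' > 0" using e by (simp add: e'_def)
    then obtain m where m: "(1/2) ^ m < e'"
      using real_arch_pow_inv[of e' "1/2"] by auto
    have "g + \<delta> \<in> U" if \<delta>: "\<delta> \<in> mat_val_ge (int m)" for \<delta>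
    proof -
      have "dist ((g + \<delta>) $ i $ j) (g $ i $ j) < e'" for i j
      proof -
        have "dist ((g + \<delta>) $ i $ j) (g $ i $ j) \<le> 2 powi (- int m)"
          unfolding diff_mem_val_ge_iff_dist[symmetric] using \<delta> by (simp add: mat_val_ge_def)
        then show ?thesis using m by (simp add: power_int_minus power_one_over inverse_eq_divide)
      qed
      then have "dist ((g + \<delta>) $ i) (g $ i) < real CARD('n) * e'" for i
        unfolding dist_vec_def[of "(g + \<delta>) $ i"]
        by (intro order.strict_trans1[OF L2_set_le_sum] sum_bounded_above_strict) (auto simp: less_imp_le)
      then have "dist (g + \<delta>) g < real CARD('m) * (real CARD('n) * e')"
        unfolding dist_vec_def[of "g + \<delta>"]
        by (intro order.strict_trans1[OF L2_set_le_sum] sum_bounded_above_strict) (auto simp: less_imp_le)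
      then show ?thesis using e by (simp add: e'_def)
    qed
    then show "\<exists>m. \<forall>\<delta>\<in>mat_val_ge m. g + \<delta> \<in> U" by blast
  next
    fix m assume m: "\<forall>\<delta>\<in>mat_val_ge m. g + \<delta> \<in> U"
    have "h \<in> U" if h: "dist h g < 2 powi (- m)" for h
    proof -
      have "dist (h $ i $ j) (g $ i $ j) \<le> 2 powi (- m)" for i j
        using h dist_vec_nth_le[of h i g] dist_vec_nth_le[of "h $ i" j "g $ i"] by linarith
      then have "h - g \<in> mat_val_ge m"
        by (simp add: mat_val_ge_def diff_mem_val_ge_iff_dist)
      then show ?thesis using m by force
    qed
    then show "\<exists>e>0. \<forall>h. dist h g < e \<longrightarrow> h \<in> U"
      by (intro exI[of _ "2 powi (- m)"]) auto
  qed
  then show ?thesis by (simp add: open_dist)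
qed

lemma matrix_add_rdistrib: "(A + B) ** C = A ** C + B ** C"
  for A B :: "'a::semiring_1 ^ 'n ^ 'm" and C :: "'a ^ 'k ^ 'n"
  by (simp add: vec_eq_iff matrix_matrix_mult_def sum.distrib distrib_right)

text \<open>Multiplication by a matrix in \<open>mat_val_ge s\<close> shifts valuation bounds by
  \<open>s\<close>, hence carries \<open>mat_val_ge (m - s)\<close> into
  \<open>mat_val_ge m\<close>.\<close>

lemma continuous_on_matrix_mult_left: "continuous_on S (\<lambda>g. a ** g)"
  for a :: "'a::idom fls ^ 'n ^ 'm" and S :: "('a fls ^ 'k ^ 'n) set"
proof -
  have "open ((\<lambda>g. a ** g) -` U)" if "open U" for U :: "('a fls ^ 'k ^ 'm) set"
    unfolding open_mat_iff
  proof safe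
    fix g assume "a ** g \<in> U"
    then obtain m s where "\<forall>\<delta>\<in>mat_val_ge m. a ** g + \<delta> \<in> U" "a \<in> mat_val_ge s"
      using \<open>open U\<close> ex_mat_val_ge unfolding open_mat_iff by meson
    then show "\<exists>m. \<forall>\<delta>\<in>mat_val_ge m. g + \<delta> \<in> (\<lambda>g. a ** g) -` U"
      using mat_val_ge_mult[of a s _ "m - s"]
      by (intro exI[of _ "m - s"]) (auto simp: matrix_add_ldistrib)
  qed
  then have "continuous_on UNIV (\<lambda>g :: 'a fls ^ 'k ^ 'n. a ** g)"
    by (simp add: continuous_on_open_vimage)
  then show ?thesis by (rule continuous_on_subset) simp
qed

lemma continuous_on_matrix_mult_right: "continuous_on S (\<lambda>g. g ** a)"
  for a :: "'a::idom fls ^ 'k ^ 'n" and S :: "('a fls ^ 'n ^ 'm) set"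
proof -
  have "open ((\<lambda>g. g ** a) -` U)" if "open U" for U :: "('a fls ^ 'k ^ 'm) set"
    unfolding open_mat_iff
  proof safe
    fix g assume "g ** a \<in> U"
    then obtain m s where "\<forall>\<delta>\<in>mat_val_ge m. g ** a + \<delta> \<in> U" "a \<in> mat_val_ge s"
      using \<open>open U\<close> ex_mat_val_ge unfolding open_mat_iff by meson
    then show "\<exists>m. \<forall>\<delta>\<in>mat_val_ge m. g + \<delta> \<in> (\<lambda>g. g ** a) -` U"
      using mat_val_ge_mult[of _ "m - s" a s]
      by (intro exI[of _ "m - s"]) (auto simp: matrix_add_rdistrib)
  qed
  then have "continuous_on UNIV (\<lambda>g :: 'a fls ^ 'n ^ 'm. g ** a)"
    by (simp add: continuous_on_open_vimage)
  then show ?thesis by (rule continuous_on_subset) simp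
qed

section \<open>Sets of matrices bounded together with their inverses\<close>

definition bounded_GL :: "nat \<Rightarrow> ('a::field fls ^ 'n ^ 'n) set" where
  "bounded_GL n = {g. g \<in> mat_val_ge 0 \<and>
     (\<exists>h. g ** h = mat 1 \<and> h ** g = mat 1 \<and> h \<in> mat_val_ge (- int n))}"

lemma bounded_GL_subset: "bounded_GL n \<subseteq> carrier GL"
  by (auto simp: bounded_GL_def invertible_def)

lemma bounded_GL_mono: "m \<le> n \<Longrightarrow> bounded_GL m \<subseteq> bounded_GL n"
  using mat_val_ge_mono[of _ "- int m" "- int n"] by (auto simp: bounded_GL_def)

text \<open>
  The inverse \<open>k\<close> of the perturbed matrix satisfies \<open>k = h - h \<delta> k\<close> with \<open>h \<delta>\<close> of positive
  valuation, so any crude lower bound on the valuation of \<open>k\<close> improves itself step by step.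
\<close>

lemma bounded_GL_perturb:
  assumes g: "g \<in> bounded_GL n" and \<delta>: "\<delta> \<in> mat_val_ge (int n + 1)" and inv: "invertible (g + \<delta>)"
  shows "g + \<delta> \<in> bounded_GL n"
proof -
  obtain h where h: "g ** h = mat 1" "h ** g = mat 1" "h \<in> mat_val_ge (- int n)"
    using g by (auto simp: bounded_GL_def)
  obtain k where k: "(g + \<delta>) ** k = mat 1" "k ** (g + \<delta>) = mat 1"
    using inv by (auto simp: invertible_def)
  have "h = h ** ((g + \<delta>) ** k)" by (simp add: k matrix_mul_rid)
  also have "\<dots> = k + (h ** \<delta>) ** k"
    by (simp add: matrix_add_rdistrib matrix_add_ldistrib matrix_mul_assoc h matrix_mul_lid)
  finally have k_eq: "k = h - (h ** \<delta>) ** k" by (simp add: algebra_simps)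
  have "h ** \<delta> \<in> mat_val_ge 1" using mat_val_ge_mult[OF h(3) \<delta>] by simp
  then have improve: "k \<in> mat_val_ge (min (- int n) (1 + s))" if "k \<in> mat_val_ge s" for s
  proof -
    have "h ** \<delta> ** k \<in> mat_val_ge (1 + s)" using mat_val_ge_mult \<open>h ** \<delta> \<in> mat_val_ge 1\<close> that .
    then show ?thesis
      by (subst k_eq, intro mat_val_ge_diff) (use h(3) in \<open>auto elim: mat_val_ge_mono\<close>)
  qed
  have "k \<in> mat_val_ge (min (- int n) (s + int j))" if "k \<in> mat_val_ge s" for s j
  proof (induction j)
    case 0 then show ?case using that by (auto elim: mat_val_ge_mono)
  next
    case (Suc j) then show ?case using improve[OF Suc] by (auto elim: mat_val_ge_mono)
  qed
  moreover obtain s where "k \<in> mat_val_ge s" using ex_mat_val_ge by blast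
  ultimately have "k \<in> mat_val_ge (min (- int n) (s + int (nat (- s))))" by blast
  then have "k \<in> mat_val_ge (- int n)" by (rule mat_val_ge_mono) auto
  moreover have "g + \<delta> \<in> mat_val_ge 0"
    using g mat_val_ge_mono[OF \<delta>, of 0] by (simp add: bounded_GL_def mat_val_ge_add)
  ultimately show ?thesis using k by (auto simp: bounded_GL_def)
qed

text \<open>Thickening by the additive subgroup \<open>mat_val_ge (int n + 1)\<close> gives a union
  of cosets, hence an open set, and by \<open>bounded_GL_perturb\<close> it adds no new invertible
  matrices.\<close>

lemma openin_bounded_GL:
  "openin (top_of_set (carrier GL)) (bounded_GL n :: ('a::field fls ^ 'n ^ 'n) set)"
proof -
  define T :: "('a fls ^ 'n ^ 'n) set"
    where "T = {g + \<delta> |g \<delta>. g \<in> bounded_GL n \<and> \<delta> \<in> mat_val_ge (int n + 1)}"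
  have "open T"
    unfolding open_mat_iff
  proof
    fix g assume "g \<in> T"
    then obtain g0 \<delta>0 where g: "g = g0 + \<delta>0" "g0 \<in> bounded_GL n" "\<delta>0 \<in> mat_val_ge (int n + 1)"
      by (auto simp: T_def)
    have "g + \<delta> \<in> T" if "\<delta> \<in> mat_val_ge (int n + 1)" for \<delta>
      unfolding T_def using g mat_val_ge_add[OF g(3) that] by (auto simp: add.assoc)
    then show "\<exists>m. \<forall>\<delta>\<in>mat_val_ge m. g + \<delta> \<in> T" by blast
  qed
  moreover have "bounded_GL n = carrier GL \<inter> T"
  proof safe
    fix g :: "'a fls ^ 'n ^ 'n" assume g: "g \<in> bounded_GL n"
    then show "g \<in> carrier GL" using bounded_GL_subset by blast
    have "0 \<in> (mat_val_ge (int n + 1) :: ('a fls ^ 'n ^ 'n) set)" by (simp add: mat_val_ge_def)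
    then have "g + 0 \<in> T" unfolding T_def using g by blast
    then show "g \<in> T" by simp
  qed (auto simp: T_def bounded_GL_perturb)
  ultimately show ?thesis by (auto simp: openin_open)
qed

section \<open>The quotient map from matrices to lattice classes\<close>

lemma lat_class_eq_iff_GL_R:
  assumes g: "invertible g" and h: "invertible h"
  shows "lat_class g = lat_class h \<longleftrightarrow> (\<exists>c \<gamma>. c \<noteq> 0 \<and> \<gamma> \<in> GL_R \<and> g = mat c ** h ** \<gamma>)"
proof -
  interpret P: group PGL by (rule group_PGL)
  have "lat_class g = lat_class h \<longleftrightarrow> proj g \<in> proj h <#\<^bsub>PGL\<^esub> PGL_R"
    using P.l_repr_independence[OF _ _ subgroup_PGL_R, of "proj g" "proj h"]
      P.lcos_self[OF _ subgroup_PGL_R, of "proj g"] g h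
    unfolding lat_class_def by (metis GL_simps(1) carrier_PGL imageI)
  also have "\<dots> \<longleftrightarrow> (\<exists>\<gamma>\<in>GL_R. proj g = proj (h ** \<gamma>))"
    by (auto simp: l_coset_def PGL_R_def proj_mult h GL_R_invertible)
  also have "\<dots> \<longleftrightarrow> (\<exists>\<gamma>\<in>GL_R. \<exists>c. c \<noteq> 0 \<and> g = mat c ** (h ** \<gamma>))"
    by (intro bex_cong refl proj_eq_iff[OF g] invertible_mult h GL_R_invertible)
  finally show ?thesis by (auto simp: matrix_mul_assoc)
qed

text \<open>The two successive quotients compose to one, so topological questions about classes can
  be settled on matrices, bypassing \<open>PGL\<close>.\<close>

lemma quotient_map_lat_class: "quotient_map (top_of_set (carrier GL)) Ld_topology lat_class"
proof -
  have "lat_class = (\<lambda>u. u <#\<^bsub>PGL\<^esub> PGL_R) \<circ> proj" by (auto simp: lat_class_def)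
  then show ?thesis
    unfolding Ld_topology_def PGL_topology_def
    by (metis quotient_map_compose quotient_map_quot_topology)
qed

text \<open>The saturation of an open set is a union of translates by scalars on the left and by
  \<open>GL_R\<close> on the right, each open by continuity of multiplication by a fixed
  matrix.\<close>

lemma open_map_lat_class: "open_map (top_of_set (carrier GL)) Ld_topology lat_class"
  unfolding open_map_def
proof safe
  fix U :: "('a fls ^ 'n ^ 'n) set" assume "openin (top_of_set (carrier GL)) U"
  then obtain T where T: "open T" "U = carrier GL \<inter> T" by (auto simp: openin_open)
  \<comment> \<open>Using \<open>T\<close> instead of \<open>U\<close> makes \<open>V\<close> open
    among all matrices. For invertible \<open>g\<close> the product
    \<open>mat c ** g ** \<gamma>\<close> is invertible, so it lies in \<open>T\<close> exactly when
    it lies in \<open>U\<close>.\<close>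
  define V where "V = (\<Union>c\<in>-{0}. \<Union>\<gamma>\<in>GL_R. (\<lambda>g. mat c ** g) -` (\<lambda>g. g ** \<gamma>) -` T)"
  have "open V"
    unfolding V_def using T(1) continuous_on_matrix_mult_left[of UNIV] continuous_on_matrix_mult_right[of UNIV]
    by (intro open_UN ballI open_vimage)
  have "lat_class g \<in> lat_class ` U \<longleftrightarrow> g \<in> V" if g: "invertible g" for g
  proof -
    have "lat_class g \<in> lat_class ` U \<longleftrightarrow> (\<exists>h\<in>U. \<exists>c \<gamma>. c \<noteq> 0 \<and> \<gamma> \<in> GL_R \<and> h = mat c ** g ** \<gamma>)"
      using lat_class_eq_iff_GL_R[OF _ g] T by (auto simp: image_iff eq_commute[of "lat_class g"])
    also have "\<dots> \<longleftrightarrow> (\<exists>c \<gamma>. c \<noteq> 0 \<and> \<gamma> \<in> GL_R \<and> mat c ** g ** \<gamma> \<in> T)"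
      using g unfolding T(2) by (metis GL_R_invertible GL_simps(1) IntD2 IntI invertible_mat invertible_mult)
    also have "\<dots> \<longleftrightarrow> g \<in> V" by (auto simp: V_def)
    finally show ?thesis .
  qed
  then have "{g \<in> topspace (top_of_set (carrier GL)). lat_class g \<in> lat_class ` U} = carrier GL \<inter> V"
    by auto
  then have "openin (top_of_set (carrier GL)) {g \<in> topspace (top_of_set (carrier GL)). lat_class g \<in> lat_class ` U}"
    using openin_open_Int[OF \<open>open V\<close>] by (simp only:)
  moreover have "lat_class ` U \<subseteq> topspace Ld_topology"
    using T by (auto simp: topspace_Ld')
  ultimately show "openin Ld_topology (lat_class ` U)"
    using quotient_map_lat_class unfolding quotient_map_def by blast
qed

text \<open>Inherited from the metric on matrices through an open continuous surjection. It allows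
  convergent subsequences to be extracted in compact sets, as the hypothesis on limit points
  requires.\<close>

lemma first_countable_Ld: "first_countable Ld_topology"
proof (rule first_countable_open_map_image)
  show "continuous_map (top_of_set (carrier GL)) Ld_topology lat_class"
    by (rule quotient_imp_continuous_map[OF quotient_map_lat_class])
  show "lat_class ` topspace (top_of_set (carrier GL)) = topspace Ld_topology"
    by (rule quotient_imp_surjective_map[OF quotient_map_lat_class])
  show "first_countable (top_of_set (carrier GL))"
    by (intro first_countable_subtopology metrizable_imp_first_countable metrizable_space_euclidean)
qed (rule open_map_lat_class)

lemma continuous_map_act:
  fixes a :: "'a::field fls ^ 'n ^ 'n"
  assumes "invertible a"
  shows "continuous_map Ld_topology Ld_topology (act (proj a))"
proof (rule continuous_compose_quotient_map[OF quotient_map_lat_class])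
  have "continuous_map (top_of_set (carrier GL)) (top_of_set (carrier GL)) (\<lambda>g. a ** g)"
    using continuous_on_matrix_mult_left assms by (auto simp: invertible_mult)
  then have "continuous_map (top_of_set (carrier GL)) Ld_topology (lat_class \<circ> (\<lambda>g. a ** g))"
    by (rule continuous_map_compose[OF _ quotient_imp_continuous_map[OF quotient_map_lat_class]])
  then show "continuous_map (top_of_set (carrier GL)) Ld_topology (act (proj a) \<circ> lat_class)"
    by (rule continuous_map_eq) (simp add: act_lat_class assms)
qed

text \<open>The images of the sets \<open>bounded_GL n\<close> form an increasing open cover, so a
  compact set lies in a single one. They cover because every class has a representative with entries
  of nonnegative valuation, and the inverse of that matrix satisfies some valuation bound.\<close>

lemma compactin_Ld_subset_bounded:
  fixes K :: "('a::field fls ^ 'n ^ 'n) set set set"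
  assumes "compactin Ld_topology K"
  obtains n where "K \<subseteq> lat_class ` bounded_GL n"
proof -
  let ?U = "\<lambda>n. lat_class ` bounded_GL n :: ('a fls ^ 'n ^ 'n) set set set"
  have "openin Ld_topology (?U n)" for n
    using open_map_lat_class openin_bounded_GL by (auto simp: open_map_def)
  moreover have "\<exists>n. lat_class g \<in> ?U n" if g: "invertible g" for g
  proof -
    obtain m where m: "g \<in> mat_val_ge m" using ex_mat_val_ge by blast
    \<comment> \<open>The power of \<open>fls_X\<close> that moves the valuation bound
      \<open>m\<close> of \<open>g\<close> to \<open>0\<close>.\<close>
    define c :: "'a fls" where "c = fls_X_intpow (- m)"
    have c: "c \<noteq> 0" unfolding c_def by (rule fls_X_intpow_nonzero)
    have c_val: "c \<in> val_ge (- m)" by (simp add: c_def val_ge_def)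
    have inv: "invertible (mat c ** g)" by (intro invertible_mult invertible_mat c g)
    then obtain h where h: "mat c ** g ** h = mat 1" "h ** (mat c ** g) = mat 1"
      by (auto simp: invertible_def)
    obtain s where "h \<in> mat_val_ge s" using ex_mat_val_ge by blast
    then have "h \<in> mat_val_ge (- int (nat (- s)))" by (rule mat_val_ge_mono) auto
    moreover have "mat c ** g \<in> mat_val_ge 0"
      using m val_ge_mult[OF c_val, of _ m] by (auto simp: mat_val_ge_def mat_mult_nth)
    ultimately have "mat c ** g \<in> bounded_GL (nat (- s))" using h by (auto simp: bounded_GL_def)
    moreover have "lat_class (mat c ** g) = lat_class g"
    proof -
      have "mat 1 \<in> (GL_R :: ('a fls ^ 'n ^ 'n) set)"
        using subgroup.one_closed[OF subgroup_GL_R] by simp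
      then show ?thesis unfolding lat_class_eq_iff_GL_R[OF inv g] using c by (metis matrix_mul_rid)
    qed
    ultimately show ?thesis by (metis imageI)
  qed
  then have "K \<subseteq> \<Union>(range ?U)"
    using compactin_subset_topspace[OF assms] by (force simp: topspace_Ld')
  ultimately obtain F where F: "finite F" "F \<subseteq> range ?U" "K \<subseteq> \<Union>F"
    using assms unfolding compactin_def by (metis (no_types, lifting) imageE)
  then obtain N where N: "finite N" "F = ?U ` N" by (meson finite_subset_image)
  obtain n where "N \<subseteq> {..n}" using N(1) finite_nat_iff_bounded_le by blast
  then have "?U i \<subseteq> ?U n" if "i \<in> N" for i
    using that by (intro image_mono bounded_GL_mono) auto
  then have "K \<subseteq> ?U n" using F(3) N(2) by blast
  then show ?thesis using that by blast
qed

section \<open>Diagonal matrices with class in a bounded set\<close>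

lemma subdegree_of_R_le: "of_R p \<noteq> 0 \<Longrightarrow> fls_subdegree (of_R p) \<le> 0"
  by (metis not_le nth_fls_subdegree_nonzero of_R_nth_pos)

lemma diag_mult_nth:
  fixes a :: "'a::comm_semiring_1 ^ 'n ^ 'n"
  assumes "\<forall>i j. i \<noteq> j \<longrightarrow> a $ i $ j = 0"
  shows "(a ** g) $ i $ j = a $ i $ i * g $ i $ j"
proof -
  have "(a ** g) $ i $ j = (\<Sum>k\<in>UNIV. if k = i then a $ i $ i * g $ i $ j else 0)"
    unfolding matrix_matrix_mult_def vec_lambda_beta using assms by (intro sum.cong) auto
  then show ?thesis by simp
qed

lemma diag_mult_diag:
  fixes a b :: "'a::comm_semiring_1 ^ 'n ^ 'n"
  assumes "\<forall>i j. i \<noteq> j \<longrightarrow> a $ i $ j = 0" "\<forall>i j. i \<noteq> j \<longrightarrow> b $ i $ j = 0"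
  shows "\<forall>i j. i \<noteq> j \<longrightarrow> (a ** b) $ i $ j = 0"
  using assms by (simp add: diag_mult_nth)

lemma mult_diag_nth:
  fixes a :: "'a::comm_semiring_1 ^ 'n ^ 'n"
  assumes "\<forall>i j. i \<noteq> j \<longrightarrow> a $ i $ j = 0"
  shows "(g ** a) $ i $ j = g $ i $ j * a $ j $ j"
proof -
  have "(g ** a) $ i $ j = (\<Sum>k\<in>UNIV. if k = j then g $ i $ j * a $ j $ j else 0)"
    unfolding matrix_matrix_mult_def vec_lambda_beta using assms by (intro sum.cong) auto
  then show ?thesis by simp
qed

lemma invertible_diag_nonzero:
  fixes a :: "'a::comm_semiring_1 ^ 'n ^ 'n"
  assumes "\<forall>i j. i \<noteq> j \<longrightarrow> a $ i $ j = 0" and "invertible a"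
  shows "a $ i $ i \<noteq> 0"
proof
  assume 0: "a $ i $ i = 0"
  obtain b where "a ** b = mat 1" using assms(2) by (auto simp: invertible_def)
  then have "(a ** b) $ i $ i = 1" by (simp add: mat_def)
  then show False by (simp add: diag_mult_nth[OF assms(1)] 0)
qed

lemma invertible_column_nonzero:
  fixes g h :: "'a::comm_semiring_1 ^ 'n ^ 'n"
  assumes "h ** g = mat 1"
  obtains k where "g $ k $ i \<noteq> 0"
proof -
  have "(\<Sum>k\<in>UNIV. h $ i $ k * g $ k $ i) = (h ** g) $ i $ i" by (simp add: matrix_matrix_mult_def)
  also have "\<dots> \<noteq> 0" by (simp add: assms mat_def)
  finally have "\<exists>k. g $ k $ i \<noteq> 0" by (rule contrapos_np) simp
  then show ?thesis using that by blast
qed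

lemma invertible_row_nonzero:
  fixes g h :: "'a::comm_semiring_1 ^ 'n ^ 'n"
  assumes "g ** h = mat 1"
  obtains k where "g $ i $ k \<noteq> 0"
proof -
  have "(\<Sum>k\<in>UNIV. g $ i $ k * h $ k $ i) = (g ** h) $ i $ i" by (simp add: matrix_matrix_mult_def)
  also have "\<dots> \<noteq> 0" by (simp add: assms mat_def)
  finally have "\<exists>k. g $ i $ k \<noteq> 0" by (rule contrapos_np) simp
  then show ?thesis using that by blast
qed

text \<open>The subdegree of the scalar \<open>c\<close> is squeezed between the two sides:
  \<open>h ** a = mat c ** \<gamma>\<close> bounds it from below through \<open>a $ i $ i\<close>,
  and \<open>a ** \<eta> = mat c ** g\<close> from above through \<open>a $ j $ j\<close>. As
  \<open>a\<close> is diagonal, entries of these products are single terms, and they are read off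
  where the polynomial matrix is nonzero.\<close>

lemma diag_subdegree_spread:
  fixes a :: "'a::field fls ^ 'n ^ 'n"
  assumes diag: "\<forall>i j. i \<noteq> j \<longrightarrow> a $ i $ j = 0" and inv: "invertible a"
    and "lat_class a \<in> lat_class ` bounded_GL n"
  shows "fls_subdegree (a $ i $ i) \<le> fls_subdegree (a $ j $ j) + int n"
proof -
  obtain g where g: "g \<in> bounded_GL n" "lat_class a = lat_class g" using assms(3) by blast
  then have "invertible g" using bounded_GL_subset by fastforce
  then obtain c \<gamma> where c: "c \<noteq> 0" and \<gamma>: "\<gamma> \<in> GL_R" and a: "a = mat c ** g ** \<gamma>"
    using lat_class_eq_iff_GL_R[OF inv] g(2) by blast
  obtain h where h: "g ** h = mat 1" "h ** g = mat 1" "h \<in> mat_val_ge (- int n)"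
    and g0: "g \<in> mat_val_ge 0"
    using g(1) by (auto simp: bounded_GL_def)
  obtain \<eta> where \<eta>: "\<gamma> ** \<eta> = mat 1" "\<eta> ** \<gamma> = mat 1"
    and poly: "\<And>i j. \<gamma> $ i $ j \<in> range of_R" "\<And>i j. \<eta> $ i $ j \<in> range of_R"
    using \<gamma> unfolding GL_R_iff by blast
  have a0: "a $ i $ i \<noteq> 0" for i by (rule invertible_diag_nonzero[OF diag inv])
  have "fls_subdegree (a $ i $ i) - int n \<le> fls_subdegree c"
  proof -
    obtain k where k: "\<gamma> $ k $ i \<noteq> 0" using invertible_column_nonzero[OF \<eta>(2)] .
    have "h ** a = mat c ** \<gamma>"
      unfolding a by (metis h(2) mat_commute matrix_mul_assoc matrix_mul_lid)
    then have eq: "h $ k $ i * a $ i $ i = c * \<gamma> $ k $ i"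
      by (metis mult_diag_nth[OF diag] mat_mult_nth)
    then have "h $ k $ i \<noteq> 0" using c k by auto
    then have "- int n \<le> fls_subdegree (h $ k $ i)"
      using h(3) by (auto simp: mat_val_ge_def simp flip: val_ge_iff_subdegree)
    moreover have "fls_subdegree (h $ k $ i) + fls_subdegree (a $ i $ i) = fls_subdegree c + fls_subdegree (\<gamma> $ k $ i)"
      using arg_cong[OF eq, of fls_subdegree] \<open>h $ k $ i \<noteq> 0\<close> a0 c k by simp
    moreover have "fls_subdegree (\<gamma> $ k $ i) \<le> 0"
      using poly(1)[of k i] k subdegree_of_R_le by auto
    ultimately show ?thesis by linarith
  qed
  moreover have "fls_subdegree c \<le> fls_subdegree (a $ j $ j)"
  proof -
    obtain k where k: "\<eta> $ j $ k \<noteq> 0" using invertible_row_nonzero[OF \<eta>(2)] .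
    have "a ** \<eta> = mat c ** g"
      unfolding a by (metis \<eta>(1) matrix_mul_assoc matrix_mul_rid)
    then have eq: "a $ j $ j * \<eta> $ j $ k = c * g $ j $ k"
      by (metis diag_mult_nth[OF diag] mat_mult_nth)
    then have "g $ j $ k \<noteq> 0" using a0 k by auto
    then have "0 \<le> fls_subdegree (g $ j $ k)"
      using g0 by (auto simp: mat_val_ge_def simp flip: val_ge_iff_subdegree)
    moreover have "fls_subdegree (a $ j $ j) + fls_subdegree (\<eta> $ j $ k) = fls_subdegree c + fls_subdegree (g $ j $ k)"
      using arg_cong[OF eq, of fls_subdegree] \<open>g $ j $ k \<noteq> 0\<close> a0 c k by simp
    moreover have "fls_subdegree (\<eta> $ j $ k) \<le> 0"
      using poly(2)[of j k] k subdegree_of_R_le by auto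
    ultimately show ?thesis by linarith
  qed
  ultimately show ?thesis by linarith
qed

section \<open>Sequential compactness\<close>

lemma compactin_first_countable_subsequence:
  fixes f :: "nat \<Rightarrow> 'b"
  assumes X: "first_countable X" and K: "compactin X K" and f: "\<And>n. f n \<in> K"
  obtains l r where "l \<in> K" "strict_mono r" "limitin X (f \<circ> r) l sequentially"
proof -
  have KX: "K \<subseteq> topspace X" by (rule compactin_subset_topspace[OF K])
  \<comment> \<open>Existence of a cluster point: otherwise finitely many open sets, each visited
    finitely often, would cover \<open>K\<close>.\<close>
  have "\<exists>l\<in>K. \<forall>U. openin X U \<longrightarrow> l \<in> U \<longrightarrow> infinite {n. f n \<in> U}"
  proof (rule ccontr)
    assume "\<not> ?thesis"
    then have "K \<subseteq> \<Union>{U. openin X U \<and> finite {n. f n \<in> U}}" by blast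
    then obtain F where F: "finite F" "F \<subseteq> {U. openin X U \<and> finite {n. f n \<in> U}}" "K \<subseteq> \<Union>F"
      using compactinD[OF K, of "{U. openin X U \<and> finite {n. f n \<in> U}}"] by auto
    have "n \<in> (\<Union>U\<in>F. {n. f n \<in> U})" for n using f[of n] F(3) by auto
    then have "UNIV = (\<Union>U\<in>F. {n. f n \<in> U})" by (intro equalityI subsetI UNIV_I)
    moreover have "finite (\<Union>U\<in>F. {n. f n \<in> U})" using F(1,2) by auto
    ultimately show False using infinite_UNIV_nat by simp
  qed
  then obtain l where l: "l \<in> K" "\<And>U. openin X U \<Longrightarrow> l \<in> U \<Longrightarrow> infinite {n. f n \<in> U}" by blast
  obtain \<B> where \<B>: "countable \<B>" "\<And>V. V \<in> \<B> \<Longrightarrow> openin X V"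
    "\<And>U. openin X U \<Longrightarrow> l \<in> U \<Longrightarrow> \<exists>V\<in>\<B>. l \<in> V \<and> V \<subseteq> U"
    using X l(1) KX unfolding first_countable_def by (metis subsetD)
  define \<C> where "\<C> = {V \<in> \<B>. l \<in> V}"
  have \<C>: "countable \<C>" "\<C> \<noteq> {}" "\<And>V. V \<in> \<C> \<Longrightarrow> openin X V \<and> l \<in> V"
    using \<B> l(1) KX openin_topspace[of X] by (auto simp: \<C>_def) blast
  \<comment> \<open>Finite intersections turn the local base into a decreasing one. As
    \<open>\<C>\<close> is nonempty, \<open>from_nat_into \<C>\<close> stays in \<open>\<C>\<close>
    even if \<open>\<C>\<close> is finite.\<close>
  define W where "W n = (\<Inter>i\<le>n. from_nat_into \<C> i)" for n
  have W: "openin X (W n)" "l \<in> W n" for n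
    using \<C>(3) from_nat_into[OF \<C>(2)] unfolding W_def by (auto intro!: openin_INT2)
  have "\<exists>m>k. f m \<in> W n" for k n
    using l(2)[OF W, of n] by (simp add: infinite_nat_iff_unbounded)
  then obtain g where g: "\<And>k n. g k n > k" "\<And>k n. f (g k n) \<in> W n" by metis
  \<comment> \<open>Each index is chosen beyond the previous one and with value in the next
    \<open>W\<close>; starting at \<open>g 0 0\<close> secures \<open>f (r n) \<in> W n\<close>
    already for \<open>n = 0\<close>.\<close>
  define r where "r = rec_nat (g 0 0) (\<lambda>n k. g k (Suc n))"
  have r_Suc: "r (Suc n) = g (r n) (Suc n)" for n by (simp add: r_def)
  have "strict_mono r" by (simp add: strict_mono_Suc_iff r_Suc g)
  have fr: "f (r n) \<in> W n" for n by (cases n) (auto simp: r_Suc g, simp add: r_def g)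
  have "limitin X (f \<circ> r) l sequentially"
    unfolding limitin_def
  proof (intro conjI allI impI)
    show "l \<in> topspace X" using l(1) KX by blast
    fix U assume U: "openin X U \<and> l \<in> U"
    then obtain V where V: "V \<in> \<C>" "V \<subseteq> U" using \<B>(3) by (auto simp: \<C>_def)
    then obtain i where "from_nat_into \<C> i = V" using from_nat_into_surj[OF \<C>(1)] by blast
    then have "W n \<subseteq> U" if "n \<ge> i" for n using V(2) that by (auto simp: W_def)
    then show "\<forall>\<^sub>F n in sequentially. (f \<circ> r) n \<in> U"
      using fr by (auto simp: eventually_sequentially)
  qed
  then show ?thesis using that l(1) \<open>strict_mono r\<close> by blast
qed

section \<open>Diagonal translations and escape from compact sets\<close>

definition diag_power :: "'n \<Rightarrow> nat \<Rightarrow> 'a::field fls ^ 'n ^ 'n" where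
  "diag_power r p = (\<chi> i j. if i \<noteq> j then 0 else if i = r then fls_X ^ p else 1)"

lemma diag_power_nth:
  "i \<noteq> j \<Longrightarrow> diag_power r p $ i $ j = 0"
  "diag_power r p $ i $ i = (if i = r then fls_X ^ p else 1)"
  by (simp_all add: diag_power_def)

lemma diag_power_add: "diag_power r p ** diag_power r q = diag_power r (p + q)"
proof -
  have "\<forall>i j. i \<noteq> j \<longrightarrow> diag_power r p $ i $ j = 0" by (simp add: diag_power_nth)
  then show ?thesis
    by (auto simp: vec_eq_iff diag_mult_nth diag_power_def power_add)
qed

lemma invertible_diag_power: "invertible (diag_power r p :: 'a::field fls ^ 'n ^ 'n)"
proof -
  define b :: "'a fls ^ 'n ^ 'n"
    where "b = (\<chi> i j. if i \<noteq> j then 0 else if i = r then inverse (fls_X ^ p) else 1)"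
  have "\<forall>i j. i \<noteq> j \<longrightarrow> diag_power r p $ i $ j = 0" "\<forall>i j. i \<noteq> j \<longrightarrow> b $ i $ j = 0"
    by (simp_all add: diag_power_nth b_def)
  then have "diag_power r p ** b = mat 1" "b ** diag_power r p = mat 1"
    by (auto simp: vec_eq_iff diag_mult_nth diag_power_def b_def mat_def)
  then show ?thesis unfolding invertible_def by blast
qed

lemma proj_diag_power_PA: "proj (diag_power r p) \<in> PA"
  unfolding PA_def by (intro imageI) (simp add: invertible_diag_power diag_power_nth)

lemma act_act:
  assumes "invertible a" "invertible b" "y \<in> topspace Ld_topology"
  shows "act (proj a) (act (proj b) y) = act (proj (a ** b)) y"
  using assms by (auto simp: topspace_Ld' act_lat_class invertible_mult matrix_mul_assoc)

lemma A_orbit_subset: "y \<in> topspace Ld_topology \<Longrightarrow> A_orbit y \<subseteq> topspace Ld_topology"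
  by (auto simp: A_orbit_def PA_def topspace_Ld' act_lat_class invertible_mult)

lemma act_A_orbit:
  assumes y: "y \<in> topspace Ld_topology" and z: "z \<in> A_orbit y" and a: "invertible a" "\<forall>i j. i \<noteq> j \<longrightarrow> a $ i $ j = 0"
  shows "act (proj a) z \<in> A_orbit y"
proof -
  obtain b where b: "invertible b" "\<forall>i j. i \<noteq> j \<longrightarrow> b $ i $ j = 0" "z = act (proj b) y"
    using z by (auto simp: A_orbit_def PA_def)
  then have "act (proj a) z = act (proj (a ** b)) y" using act_act[OF a(1) b(1) y] by simp
  moreover have "proj (a ** b) \<in> PA"
    unfolding PA_def using a b diag_mult_diag[OF a(2) b(2)] by (auto simp: invertible_mult)
  ultimately show ?thesis by (auto simp: A_orbit_def)
qed

text \<open>For \<open>y = lat_class a\<close>, the translation raises the difference of the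
  subdegrees at \<open>r\<close> and at another index \<open>s\<close> by \<open>p\<close>, while
  this difference lies between \<open>- n\<close> and \<open>n\<close> as long as the class stays in
  \<open>K\<close>.\<close>

lemma std_orbit_escapes:
  fixes K :: "('a::field fls ^ 'n ^ 'n) set set set" and r :: 'n
  assumes card: "CARD('n) \<ge> 2" and K: "compactin Ld_topology K"
  obtains m where "\<And>p y. p \<ge> m \<Longrightarrow> y \<in> A_orbit std_class \<Longrightarrow> y \<in> K \<Longrightarrow> act (proj (diag_power r p)) y \<notin> K"
proof -
  obtain n where n: "K \<subseteq> lat_class ` bounded_GL n" using compactin_Ld_subset_bounded[OF K] .
  have "\<exists>s. s \<noteq> r"
  proof (rule ccontr)
    assume "\<not> ?thesis"
    then have "UNIV = {r}" by auto
    then have "CARD('n) = card {r}" by (rule arg_cong)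
    then show False using card by simp
  qed
  then obtain s where "s \<noteq> r" ..
  have "act (proj (diag_power r p)) y \<notin> K"
    \<comment> \<open>One \<open>n\<close> comes from the spread bound before the translation and
      one from the bound after it.\<close>
    if p: "p \<ge> 2 * n + 1" and y: "y \<in> A_orbit std_class" "y \<in> K" for p y
  proof
    assume *: "act (proj (diag_power r p)) y \<in> K"
    obtain a :: "'a fls ^ 'n ^ 'n" where a: "invertible a" "\<forall>i j. i \<noteq> j \<longrightarrow> a $ i $ j = 0"
      and "y = act (proj a) std_class"
      using y(1) by (auto simp: A_orbit_def PA_def)
    then have y_eq: "y = lat_class a" by (simp add: std_class_def act_lat_class invertible_mat)
    let ?b = "diag_power r p ** a"
    have b: "invertible ?b" "\<forall>i j. i \<noteq> j \<longrightarrow> ?b $ i $ j = 0"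
      using a diag_mult_diag[of "diag_power r p" a]
      by (auto simp: invertible_mult invertible_diag_power diag_power_nth)
    have b_nth: "?b $ i $ i = diag_power r p $ i $ i * a $ i $ i" for i
      by (rule diag_mult_nth) (simp add: diag_power_nth)
    have "act (proj (diag_power r p)) y = lat_class ?b"
      by (simp add: y_eq act_lat_class a invertible_diag_power)
    then have "fls_subdegree (?b $ r $ r) \<le> fls_subdegree (?b $ s $ s) + int n"
      using diag_subdegree_spread[OF b(2,1)] * n by auto
    then have "fls_subdegree (fls_X ^ p * a $ r $ r) \<le> fls_subdegree (a $ s $ s) + int n"
      using \<open>s \<noteq> r\<close> by (simp only: b_nth diag_power_nth if_True if_False simp_thms mult_1)
    moreover have "fls_subdegree (fls_X ^ p * a $ r $ r) = int p + fls_subdegree (a $ r $ r)"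
      using invertible_diag_nonzero[OF a(2,1)] by (subst fls_subdegree_mult) auto
    moreover have "fls_subdegree (a $ s $ s) \<le> fls_subdegree (a $ r $ r) + int n"
      using diag_subdegree_spread[OF a(2,1)] y(2) y_eq n by auto
    ultimately have "int p \<le> 2 * int n" by linarith
    then show False using p by linarith
  qed
  then show ?thesis using that by blast
qed

lemma closedin_act_vimage:
  assumes "invertible a" "closedin Ld_topology K"
  shows "closedin Ld_topology {y \<in> topspace Ld_topology. act (proj a) y \<in> K}"
  using closedin_continuous_map_preimage[OF continuous_map_act] assms by blast

text \<open>If infinitely many orbits met the compact set \<open>L\<close> of points returning to
  \<open>K\<close>, a subsequence of such points would converge to a point of \<open>L\<close>. By
  \<open>lim\<close> that point is on the standard orbit, contradicting \<open>esc\<close>.\<close>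

lemma eventually_no_return:
  fixes x :: "nat \<Rightarrow> ('a::field fls ^ 'n ^ 'n) set set"
  assumes x: "\<And>k. x k \<in> topspace Ld_topology"
    and lim: "\<And>a r y. (\<And>k. a k \<in> PA) \<Longrightarrow> strict_mono (r :: nat \<Rightarrow> nat) \<Longrightarrow>
           limitin Ld_topology (\<lambda>k. act (a (r k)) (x (r k))) y sequentially \<Longrightarrow>
           y \<in> A_orbit std_class"
    and K: "compactin Ld_topology K" "closedin Ld_topology K"
    and g: "invertible g"
    and esc: "\<And>y. y \<in> A_orbit std_class \<Longrightarrow> y \<in> K \<Longrightarrow> act (proj g) y \<notin> K"
  shows "\<forall>\<^sub>F k in sequentially. \<forall>z\<in>A_orbit (x k). z \<in> K \<longrightarrow> act (proj g) z \<notin> K"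
proof (rule ccontr)
  define L where "L = K \<inter> {y \<in> topspace Ld_topology. act (proj g) y \<in> K}"
  have L: "compactin Ld_topology L" "closedin Ld_topology L"
    unfolding L_def using K closedin_act_vimage[OF g K(2)]
    by (auto intro: compact_Int_closedin)
  assume "\<not> ?thesis"
  then have "\<exists>\<^sub>F k in sequentially. \<exists>a\<in>PA. act a (x k) \<in> L"
    unfolding not_eventually
  proof (rule frequently_elim1)
    fix k assume "\<not> (\<forall>z\<in>A_orbit (x k). z \<in> K \<longrightarrow> act (proj g) z \<notin> K)"
    then obtain z where z: "z \<in> A_orbit (x k)" "z \<in> L"
      using A_orbit_subset[OF x[of k]] unfolding L_def by blast
    then show "\<exists>a\<in>PA. act a (x k) \<in> L" unfolding A_orbit_def by blast
  qed
  then have "infinite {k. \<exists>a\<in>PA. act a (x k) \<in> L}"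
    by (simp add: frequently_cofinite flip: cofinite_eq_sequentially)
  then obtain r :: "nat \<Rightarrow> nat" where r: "strict_mono r" "\<And>n. \<exists>a\<in>PA. act a (x (r n)) \<in> L"
    using infinite_enumerate[of "{k. \<exists>a\<in>PA. act a (x k) \<in> L}"] by auto
  define a where "a n = (SOME a. a \<in> PA \<and> act a (x (r n)) \<in> L)" for n
  have a: "a n \<in> PA" "act (a n) (x (r n)) \<in> L" for n
    using someI_ex[OF r(2)[of n, unfolded Bex_def]] by (simp_all add: a_def)
  obtain y s where y: "y \<in> L" and s: "strict_mono s"
    and lim_y: "limitin Ld_topology ((\<lambda>n. act (a n) (x (r n))) \<circ> s) y sequentially"
    using compactin_first_countable_subsequence[OF first_countable_Ld L(1) a(2)] .
  have rs: "strict_mono (r \<circ> s)" using r(1) s by (rule strict_mono_o)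
  \<comment> \<open>\<open>lim\<close> expects diagonal classes indexed like \<open>x\<close>, but
    \<open>a\<close> is indexed along \<open>r\<close>. Off the range of \<open>r\<close> the
    reindexed sequence takes some value of \<open>a\<close>, which is still in
    \<open>PA\<close>.\<close>
  define b where "b k = a (inv_into UNIV r k)" for k
  have "b (r n) = a n" for n
    using strict_mono_imp_inj_on[OF r(1)] by (simp add: b_def)
  then have "limitin Ld_topology (\<lambda>k. act (b ((r \<circ> s) k)) (x ((r \<circ> s) k))) y sequentially"
    using lim_y by (simp add: comp_def)
  then have "y \<in> A_orbit std_class" using lim[of b "r \<circ> s" y] a(1) rs by (simp add: b_def)
  then show False using esc y by (auto simp: L_def)
qed

section \<open>Borel sets and almost disjoint events\<close>

lemma space_borel_of_top [simp]: "space (borel_of_top X) = topspace X"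
  unfolding borel_of_top_def by (rule space_measure_of) (auto dest: openin_subset)

lemma sets_borel_of_top: "sets (borel_of_top X) = sigma_sets (topspace X) {U. openin X U}"
  unfolding borel_of_top_def by (intro sets_measure_of) (auto dest: openin_subset)

lemma openin_sets_borel_of_top: "openin X U \<Longrightarrow> U \<in> sets (borel_of_top X)"
  by (auto simp: sets_borel_of_top)

lemma closedin_sets_borel_of_top: "closedin X C \<Longrightarrow> C \<in> sets (borel_of_top X)"
  by (metis closedin_def double_diff openin_sets_borel_of_top sets.compl_sets space_borel_of_top subset_refl)

lemma measurable_borel_of_top:
  assumes "continuous_map X Y f"
  shows "f \<in> measurable (borel_of_top X) (borel_of_top Y)"
proof (rule measurable_sigma_sets[OF sets_borel_of_top])
  show "{U. openin Y U} \<subseteq> Pow (topspace Y)" by (auto dest: openin_subset)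
  show "f \<in> space (borel_of_top X) \<rightarrow> topspace Y" using assms by (auto simp: continuous_map_def)
  fix U assume "U \<in> {U. openin Y U}"
  then have "openin X {y \<in> topspace X. f y \<in> U}" using assms by (simp add: continuous_map_def)
  moreover have "f -` U \<inter> space (borel_of_top X) = {y \<in> topspace X. f y \<in> U}" by auto
  ultimately show "f -` U \<inter> space (borel_of_top X) \<in> sets (borel_of_top X)"
    by (simp add: openin_sets_borel_of_top)
qed

text \<open>As disjointness holds only almost everywhere, the sum of the indicators is integrated in
  place of additivity on a union; almost everywhere it is at most \<open>1\<close>.\<close>

lemma (in prob_space) card_mult_prob_le_1:
  assumes "finite I" and S: "\<And>i. i \<in> I \<Longrightarrow> S i \<in> events" "\<And>i. i \<in> I \<Longrightarrow> prob (S i) = c"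
    and disj: "AE z in M. \<forall>i\<in>I. \<forall>j\<in>I. i \<noteq> j \<longrightarrow> z \<in> S i \<longrightarrow> z \<notin> S j"
  shows "real (card I) * c \<le> 1"
proof -
  have "expectation (indicator (S i)) = c" if "i \<in> I" for i
    using S that by simp
  then have "real (card I) * c = (\<Sum>i\<in>I. expectation (indicator (S i)))"
    by simp
  also have "\<dots> = expectation (\<lambda>z. \<Sum>i\<in>I. indicator (S i) z)"
    using S(1) by (intro Bochner_Integration.integral_sum[symmetric] integrable_real_indicator) (auto simp: less_top[symmetric])
  also have "\<dots> \<le> expectation (\<lambda>z. 1)"
  proof (rule integral_mono_AE)
    show "integrable M (\<lambda>z. \<Sum>i\<in>I. indicator (S i) z :: real)"
      using S(1) by (intro Bochner_Integration.integrable_sum integrable_real_indicator) (auto simp: less_top[symmetric])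
    show "AE z in M. (\<Sum>i\<in>I. indicator (S i) z :: real) \<le> 1"
      using disj
    proof eventually_elim
      case (elim z)
      have "(\<Sum>i\<in>I. indicator (S i) z :: real) = real (card {i \<in> I. z \<in> S i})"
        using \<open>finite I\<close> by (simp add: indicator_def sum.If_cases Int_def)
      also have "card {i \<in> I. z \<in> S i} \<le> 1"
        using elim \<open>finite I\<close> by (simp add: card_le_Suc0_iff_eq) blast
      finally show ?case by simp
    qed
  qed simp
  finally show ?thesis by (simp add: prob_space)
qed

section \<open>Escape of mass of the orbit measures\<close>

theorem corollary1p13:
  fixes x :: "nat \<Rightarrow> ('a::{field,finite} fls ^ 'n ^ 'n) set set"
    and \<mu> :: "nat \<Rightarrow> ('a fls ^ 'n ^ 'n) set set measure"
  assumes "CARD('n) \<ge> 2"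
    and "\<And>k. x k \<in> topspace Ld_topology"
    and "\<And>k. compactin Ld_topology (A_orbit (x k))"
    and "\<And>a r y. (\<And>k. a k \<in> PA) \<Longrightarrow> strict_mono (r :: nat \<Rightarrow> nat) \<Longrightarrow>
           limitin Ld_topology (\<lambda>k. act (a (r k)) (x (r k))) y sequentially \<Longrightarrow>
           y \<in> A_orbit std_class"
    and "\<And>k. is_orbit_measure (x k) (\<mu> k)"
  shows "weak_star_converges Ld_topology \<mu> (null_measure (borel_of_top Ld_topology))"
  unfolding weak_star_converges_def
proof (intro allI impI)
  fix f :: "('a fls ^ 'n ^ 'n) set set \<Rightarrow> real"
  assume f: "continuous_map Ld_topology euclideanreal f \<and> compactly_supported Ld_topology f"
  \<comment> \<open>Being a closure, \<open>K\<close> is closed as well as compact, with no appeal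
    to a separation axiom; this makes \<open>K\<close> and its preimages Borel.\<close>
  define K where "K = Ld_topology closure_of {y \<in> topspace Ld_topology. f y \<noteq> 0}"
  have K: "compactin Ld_topology K" "closedin Ld_topology K"
    using f by (simp_all add: K_def compactly_supported_def)
  have f0: "f y = 0" if "y \<in> topspace Ld_topology" "y \<notin> K" for y
    using that closure_of_subset[of "{y \<in> topspace Ld_topology. f y \<noteq> 0}" Ld_topology] by (auto simp: K_def)
  have "compact (f ` K)"
    using image_compactin[OF K(1)] f by fastforce
  then obtain B where B: "\<And>y. y \<in> K \<Longrightarrow> \<bar>f y\<bar> \<le> B"
    using compact_imp_bounded[of "f ` K"] by (auto simp: bounded_iff)
  \<comment> \<open>Any coordinate can be the one that is scaled.\<close>
  define i0 :: 'n where "i0 = undefined"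
  obtain m where m: "\<And>p y. p \<ge> m \<Longrightarrow> y \<in> A_orbit std_class \<Longrightarrow> y \<in> K \<Longrightarrow>
      act (proj (diag_power i0 p)) y \<notin> K"
    using std_orbit_escapes[OF assms(1) K(1), of i0] by metis
  have sets: "sets (\<mu> k) = sets (borel_of_top Ld_topology)" and prob: "prob_space (\<mu> k)"
    and inv: "\<And>a. a \<in> PA \<Longrightarrow> distr (\<mu> k) (\<mu> k) (act a) = \<mu> k"
    and supp: "AE z in \<mu> k. z \<in> A_orbit (x k)" for k
    using assms(5)[of k] by (auto simp: is_orbit_measure_def)
  have space: "space (\<mu> k) = topspace Ld_topology" for k
    using sets_eq_imp_space_eq[OF sets[of k]] by simp
  have K_sets: "K \<in> sets (\<mu> k)" for k
    by (simp add: sets closedin_sets_borel_of_top K)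
  \<comment> \<open>Distinct exponents differ by more than \<open>m\<close>, so the escape bound
    applies to the quotient of any two of these translations.\<close>
  define g :: "nat \<Rightarrow> 'a fls ^ 'n ^ 'n" where "g i = diag_power i0 (i * Suc m)" for i
  \<comment> \<open>Preimages of \<open>K\<close> are closed by continuity, and invariance in the
    form of \<open>distr\<close> gives their measure directly.\<close>
  define S where "S i = {y \<in> topspace Ld_topology. act (proj (g i)) y \<in> K}" for i
  have g: "invertible (g i)" "proj (g i) \<in> PA" "\<forall>r s. r \<noteq> s \<longrightarrow> g i $ r $ s = 0" for i
    by (simp_all add: g_def invertible_diag_power proj_diag_power_PA diag_power_nth)
  have S_sets: "S i \<in> sets (\<mu> k)" for i k
    unfolding S_def sets by (intro closedin_sets_borel_of_top closedin_act_vimage g K)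
  have S_measure: "measure (\<mu> k) (S i) = measure (\<mu> k) K" for i k
  proof -
    have "act (proj (g i)) \<in> measurable (\<mu> k) (\<mu> k)"
      using measurable_borel_of_top[OF continuous_map_act[OF g(1)]]
      by (simp add: measurable_cong_sets[OF sets sets])
    from measure_distr[OF this K_sets] show ?thesis
      by (simp add: inv[OF g(2)] S_def space vimage_def Int_def conj_commute)
  qed
  have small: "\<forall>\<^sub>F k in sequentially. real N * measure (\<mu> k) K \<le> 1" for N
  proof -
    have "\<forall>\<^sub>F k in sequentially. \<forall>z\<in>A_orbit (x k). z \<in> K \<longrightarrow> act (proj (g i)) z \<notin> K"
      if "i > 0" for i
    proof (rule eventually_no_return[OF assms(2) _ K])
      fix y assume "y \<in> A_orbit std_class" "y \<in> K"
      moreover have "m \<le> i * Suc m" using that by (cases i) auto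
      ultimately show "act (proj (g i)) y \<notin> K" unfolding g_def by (intro m)
    qed (use assms(4) g in auto)
    \<comment> \<open>For fixed \<open>N\<close> only finitely many translations occur, so a common
      threshold for \<open>k\<close> exists.\<close>
    then have "\<forall>\<^sub>F k in sequentially. \<forall>i\<in>{1..N}. \<forall>z\<in>A_orbit (x k). z \<in> K \<longrightarrow> act (proj (g i)) z \<notin> K"
      by (intro eventually_ball_finite) auto
    then show ?thesis
    proof eventually_elim
      case (elim k)
      \<comment> \<open>A point \<open>z\<close> in both sets would give a point
        \<open>act (proj (g i)) z\<close> of the same orbit that lies in \<open>K\<close> and is
        sent back into \<open>K\<close> by \<open>g (j - i)\<close>.\<close>
      have less: "z \<notin> S j" if z: "z \<in> A_orbit (x k)" "z \<in> S i" and "i < j" "j < N" for z i j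
      proof
        assume "z \<in> S j"
        have "g j = g (j - i) ** g i"
          using \<open>i < j\<close> by (simp add: g_def diag_power_add flip: add_mult_distrib)
        then have "act (proj (g j)) z = act (proj (g (j - i))) (act (proj (g i)) z)"
          using act_act[OF g(1) g(1)] z(2) by (simp add: S_def)
        moreover have "act (proj (g i)) z \<in> A_orbit (x k)"
          by (rule act_A_orbit[OF assms(2) z(1) g(1,3)])
        moreover have "j - i \<in> {1..N}" using \<open>i < j\<close> \<open>j < N\<close> by auto
        ultimately show False
          using elim \<open>z \<in> S j\<close> z(2) unfolding S_def by fastforce
      qed
      have "AE z in \<mu> k. \<forall>i\<in>{..<N}. \<forall>j\<in>{..<N}. i \<noteq> j \<longrightarrow> z \<in> S i \<longrightarrow> z \<notin> S j"
        using supp[of k]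
      proof eventually_elim
        case (elim z)
        then show ?case using less by (metis lessThan_iff linorder_neqE_nat)
      qed
      from prob_space.card_mult_prob_le_1[OF prob _ S_sets S_measure this] show ?case by simp
    qed
  qed
  \<comment> \<open>The absolute value covers the case of empty \<open>K\<close>, where
    \<open>B\<close> may be negative.\<close>
  have bound: "\<bar>integral\<^sup>L (\<mu> k) f\<bar> \<le> \<bar>B\<bar> * measure (\<mu> k) K" for k
  proof -
    interpret prob_space "\<mu> k" by (rule prob)
    have "\<bar>integral\<^sup>L (\<mu> k) f\<bar> \<le> (\<integral>z. \<bar>f z\<bar> \<partial>\<mu> k)" by (rule integral_abs_bound)
    also have "\<dots> \<le> (\<integral>z. \<bar>B\<bar> * indicator K z \<partial>\<mu> k)"
    proof (rule integral_mono')
      show "integrable (\<mu> k) (\<lambda>z. \<bar>B\<bar> * indicator K z)"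
        using K_sets by (intro integrable_mult_right integrable_real_indicator) (auto simp: less_top[symmetric])
      fix z assume "z \<in> space (\<mu> k)"
      then show "\<bar>f z\<bar> \<le> \<bar>B\<bar> * indicator K z"
        using B[of z] f0[of z] by (auto simp: space indicator_def)
    qed simp
    also have "\<dots> = \<bar>B\<bar> * measure (\<mu> k) K" using K_sets by simp
    finally show ?thesis .
  qed
  have "(\<lambda>k. integral\<^sup>L (\<mu> k) f) \<longlonglongrightarrow> 0"
  proof (rule tendstoI)
    fix e :: real assume "e > 0"
    obtain N :: nat where N: "\<bar>B\<bar> / e < real N" using reals_Archimedean2 by blast
    then have "N > 0" using \<open>e > 0\<close> by (cases N) (auto simp: divide_less_0_iff)
    from small[of N] show "\<forall>\<^sub>F k in sequentially. dist (integral\<^sup>L (\<mu> k) f) 0 < e"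
    proof eventually_elim
      case (elim k)
      have "\<bar>B\<bar> * measure (\<mu> k) K \<le> \<bar>B\<bar> * (1 / real N)"
        using elim \<open>N > 0\<close> by (intro mult_left_mono) (simp_all add: field_simps)
      also have "\<dots> < e" using N \<open>N > 0\<close> \<open>e > 0\<close> by (simp add: field_simps)
      finally show ?case using bound[of k] by simp
    qed
  qed
  then show "(\<lambda>k. integral\<^sup>L (\<mu> k) f) \<longlonglongrightarrow> integral\<^sup>L (null_measure (borel_of_top Ld_topology)) f"
    by simp
qed

end
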